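(* Let $S=S_1+S_2+\dots+S_p$ for outer semicontinuous mappings $S_i:\mathbb{R}^n\rightrightarrows\mathbb{R}^m$. Let $\bar x\in\mathrm{dom}\,S$, $\bar u\in S(\bar x)$ and $(h,l)\in\mathbb{R}^n\times\mathbb{R}^m$. Let $$\Xi(x,u)=\{w=(w_1,\dots,w_p)\in(\mathbb{R}^m)^p\mid w_i\in S_i(x),\ i=1,\dots,p,\ \textstyle\sum_iw_i=u\}.$$ Assume that (a) there is a directional neighborhood $\mathcal{U}$ of $(h,l)$ such that $\Xi((\bar x,\bar u)+\mathcal{U})$ is bounded; (b) the multifunction of $(x,v,w)\in\mathbb{R}^n\times(\mathbb{R}^n)^p\times(\mathbb{R}^m)^p$ given by $$F(x,v,w)=\{(x,\dots,x)-(v_1,\dots,v_p)\}\times\prod_{i=1}^p\big(\mathrm{gph}\,S_i-(v_i,w_i)\big)$$ is metrically subregular at $((\bar x,(\bar x,\dots,\bar x),\tilde w),0)$ for all $\tilde w\in\Xi(\bar x,\bar u)$ in all directions $(h,(h,\dots,h),k_1,\dots,k_p)$ such that $k_i\in DS_i(\bar x,\tilde w_i)(h)$, $i=1,\dots,p$, $k_1+\dots+k_p=l$, and in all directions $(0,(0,\dots,0),k_1,\dots,k_p)$ such that $k_i\in DS_i(\bar x,\tilde w_i)(0)$, $i=1,\dots,p$, $k_1+\dots+k_p=0$ and $k:=(k_1,\dots,k_p)\in\mathbb{S}$. Then for every $u^*\in\mathbb{R}^m$, $$D^*S((\bar x,\bar u);(h,l))(u^* )\subset\bigcup_{\tilde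 w\in\Xi(\bar x,\bar u)}\Big(\bigcup_{\substack{k_i\in DS_i(\bar x,\tilde w_i)(h)\\ \sum k_i=l}}\ \sum_{i=1}^pD^*S_i((\bar x,\tilde w_i);(h,k_i))(u^* )\ \cup\bigcup_{\substack{k_i\in DS_i(\bar x,\tilde w_i)(0)\\ \sum k_i=0,\ k\in\mathbb{S}}}\ \sum_{i=1}^pD^*S_i((\bar x,\tilde w_i);(0,k_i))(u^* )\Big).$$
   Context: Euclidean norms are used; $\mathbb{S}$ is the unit sphere (here of $(\mathbb{R}^m)^p$) and $\mathbb{B}$ the closed unit ball; $t_k\downarrow0$ means $t_k>0$, $t_k\to0$; $d_A(x)$ is the distance from $x$ to $A$ ($d_\emptyset=\infty$). Outer semicontinuous means having a closed graph. $\mathrm{dom}\,S=\{x\mid S(x)\neq\emptyset\}$; sums of multifunctions and of sets are Minkowski sums. For a set $\Omega$ and $x\in\Omega$: $T_\Omega(x)=\{u\mid\exists u_k\to u,\ t_k\downarrow0:\ x+t_ku_k\in\Omega\ \forall k\}$; $\hat N_\Omega(x)=\{\xi\mid\limsup_{x'\to x,\,x'\in\Omega}\langle\xi,x'-x\rangle/\|x'-x\|\le0\}$; both are empty if $x\notin\Omega$. The limiting normal cone in direction $u$ is $N_\Omega(x;u)=\{\xi\mid\exists t_k\downarrow0,\ u_k\to u,\ \xi_k\to\xi:\ \xi_k\in\hat N_\Omega(x+t_ku_k)\ \forall k\}$. For a multifunction $M$ and $(x,y)\in\mathrm{gph}\,M$: $DM(x,y)(u)=\{v\mid(u,v)\in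 T_{\mathrm{gph}\,M}(x,y)\}$; $D^*M((x,y);(u,v))(\eta)=\{\xi\mid(\xi,-\eta)\in N_{\mathrm{gph}\,M}((x,y);(u,v))\}$. A directional neighborhood of $u$ is a set containing $\mathcal{V}_{\rho,\delta}(u):=\{z\in\rho\mathbb{B}\mid\big\|\|u\|z-\|z\|u\big\|\le\delta\|z\|\|u\|\}$ for some $\rho,\delta>0$. A multifunction $F$ is metrically subregular at $(\bar z,\bar w)\in\mathrm{gph}\,F$ in direction $u$ if there are $\kappa>0$ and a directional neighborhood $\mathcal{U}$ of $u$ with $d_{F^{-1}(\bar w)}(z)\le\kappa\,d_{F(z)}(\bar w)$ for all $z\in\bar z+\mathcal{U}$. *)

theory Defs
  imports "HOL-Analysis.Analysis"
begin

type_synonym ('a, 'b) multifun = "'a \<Rightarrow> 'b set"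

definition gph :: "('a, 'b) multifun \<Rightarrow> ('a \<times> 'b) set" where
  "gph M = {(x, y). y \<in> M x}"

definition mf_dom :: "('a, 'b) multifun \<Rightarrow> 'a set" where
  "mf_dom M = {x. M x \<noteq> {}}"

definition mf_inverse :: "('a, 'b) multifun \<Rightarrow> ('b, 'a) multifun" where
  "mf_inverse M y = {x. y \<in> M x}"

definition outer_semicontinuous ::
    "('a::topological_space, 'b::topological_space) multifun \<Rightarrow> bool" where
  "outer_semicontinuous M \<longleftrightarrow> closed (gph M)"

text \<open>The distance is extended-real-valued, with value \<open>\<infinity>\<close> for the empty set;
  \<open>infdist\<close> and \<open>setdist\<close> would return \<open>0\<close> there.\<close>

definition dist_to :: "'a::metric_space set \<Rightarrow> 'a \<Rightarrow> ereal" where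
  "dist_to A x = (INF a\<in>A. ereal (dist x a))"

definition tangent_cone :: "'a::real_normed_vector set \<Rightarrow> 'a \<Rightarrow> 'a set" where
  "tangent_cone \<Omega> x =
    (if x \<in> \<Omega> then
       {u. \<exists>(t :: nat \<Rightarrow> real) u'. (\<forall>k. t k > 0) \<and> t \<longlonglongrightarrow> 0 \<and> u' \<longlonglongrightarrow> u \<and>
             (\<forall>k. x + t k *\<^sub>R u' k \<in> \<Omega>)}
     else {})"

text \<open>If \<open>x\<close> is an isolated point of \<open>\<Omega>\<close>, the filter is trivial, the limes superior is \<open>-\<infinity>\<close>
  and the cone is the whole space.\<close>

definition regular_normal_cone :: "'a::real_inner set \<Rightarrow> 'a \<Rightarrow> 'a set" where
  "regular_normal_cone \<Omega> x =
    (if x \<in> \<Omega> then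
       {\<xi>. Limsup (at x within \<Omega>) (\<lambda>x'. ereal (\<xi> \<bullet> (x' - x) / norm (x' - x))) \<le> 0}
     else {})"

definition dir_normal_cone :: "'a::real_inner set \<Rightarrow> 'a \<Rightarrow> 'a \<Rightarrow> 'a set" where
  "dir_normal_cone \<Omega> x u =
    {\<xi>. \<exists>(t :: nat \<Rightarrow> real) u' \<xi>'. (\<forall>k. t k > 0) \<and> t \<longlonglongrightarrow> 0 \<and> u' \<longlonglongrightarrow> u \<and> \<xi>' \<longlonglongrightarrow> \<xi> \<and>
          (\<forall>k. \<xi>' k \<in> regular_normal_cone \<Omega> (x + t k *\<^sub>R u' k))}"

definition graph_deriv ::
    "('a::real_normed_vector, 'b::real_normed_vector) multifun \<Rightarrow> 'a \<times> 'b \<Rightarrow> ('a, 'b) multifun" where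
  "graph_deriv M z u = {v. (u, v) \<in> tangent_cone (gph M) z}"

definition dir_coderiv ::
    "('a::real_inner, 'b::real_inner) multifun \<Rightarrow> 'a \<times> 'b \<Rightarrow> 'a \<times> 'b \<Rightarrow> ('b, 'a) multifun" where
  "dir_coderiv M z d \<eta> = {\<xi>. (\<xi>, - \<eta>) \<in> dir_normal_cone (gph M) z d}"

definition basic_dir_nbhd :: "real \<Rightarrow> real \<Rightarrow> 'a::real_normed_vector \<Rightarrow> 'a set" where
  "basic_dir_nbhd \<rho> \<delta> u =
    {z \<in> cball 0 \<rho>. norm (norm u *\<^sub>R z - norm z *\<^sub>R u) \<le> \<delta> * norm z * norm u}"

definition dir_nbhd :: "'a::real_normed_vector \<Rightarrow> 'a set \<Rightarrow> bool" where
  "dir_nbhd u U \<longleftrightarrow> (\<exists>\<rho>>0. \<exists>\<delta>>0. basic_dir_nbhd \<rho> \<delta> u \<subseteq> U)"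

definition dir_metrically_subregular ::
    "('a::real_normed_vector, 'b::real_normed_vector) multifun \<Rightarrow> 'a \<times> 'b \<Rightarrow> 'a \<Rightarrow> bool" where
  "dir_metrically_subregular F = (\<lambda>(z0, w0) u.
    (z0, w0) \<in> gph F \<and>
    (\<exists>\<kappa>::real. \<kappa> > 0 \<and> (\<exists>U. dir_nbhd u U \<and>
      (\<forall>z \<in> (+) z0 ` U. dist_to (mf_inverse F w0) z \<le> ereal \<kappa> * dist_to (F z) w0))))"

text \<open>The index set \<open>{1, \<dots>, p}\<close> is a finite type; \<open>('c ^ 'p)\<close> carries the Euclidean norm. Sums
  of sets are the Minkowski sums of \<open>HOL-Library.Set_Algebras\<close>.\<close>

definition mf_sum :: "('p::finite \<Rightarrow> ('a, 'b::comm_monoid_add) multifun) \<Rightarrow> ('a, 'b) multifun" where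
  "mf_sum Si x = (\<Sum>i\<in>UNIV. Si i x)"

definition sum_decomp ::
    "('p::finite \<Rightarrow> ('a, 'b::comm_monoid_add) multifun) \<Rightarrow> ('a \<times> 'b, 'b ^ 'p) multifun" where
  "sum_decomp Si = (\<lambda>(x, u). {w. (\<forall>i. w $ i \<in> Si i x) \<and> (\<Sum>i\<in>UNIV. w $ i) = u})"

definition sum_constraint ::
    "('p::finite \<Rightarrow> ('a::group_add, 'b::group_add) multifun) \<Rightarrow>
      ('a \<times> ('a ^ 'p) \<times> ('b ^ 'p), ('a ^ 'p) \<times> (('a \<times> 'b) ^ 'p)) multifun" where
  "sum_constraint Si = (\<lambda>(x, v, w).
    {(\<chi> i. x) - v} \<times> {q. \<forall>i. q $ i \<in> (\<lambda>y. y - (v $ i, w $ i)) ` gph (Si i)})"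

definition dir_decomp ::
    "('p::finite \<Rightarrow> ('a::real_normed_vector, 'b::real_normed_vector) multifun) \<Rightarrow>
      'a \<Rightarrow> 'b ^ 'p \<Rightarrow> 'a \<Rightarrow> 'b \<Rightarrow> ('b ^ 'p) set" where
  "dir_decomp Si x w h l =
    {k. (\<forall>i. k $ i \<in> graph_deriv (Si i) (x, w $ i) h) \<and> (\<Sum>i\<in>UNIV. k $ i) = l}"

text \<open>The membership built into \<open>dir_metrically_subregular\<close> holds at all points of interest.\<close>

lemma sum_constraint_zero:
  fixes Si :: "'p::finite \<Rightarrow> ('a::real_normed_vector, 'b::real_normed_vector) multifun"
  assumes "w \<in> sum_decomp Si (x, u)"
  shows "((x, (\<chi> i. x), w), 0) \<in> gph (sum_constraint Si)"
proof -
  have "(0 :: 'a \<times> 'b) \<in> (\<lambda>y. y - (x, w $ i)) ` gph (Si i)" for i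
    using assms by (intro image_eqI[of _ _ "(x, w $ i)"]) (auto simp: sum_decomp_def gph_def)
  then show ?thesis
    by (auto simp: sum_constraint_def gph_def zero_prod_def)
qed

end

theory Submission
  imports Defs
begin

text \<open>
  A normal to the graph of \<open>S\<close> at \<open>(x0, u0)\<close> in direction \<open>(h, l)\<close> is a limit of regular normals at
  points \<open>(x0, u0) + t j *\<^sub>R d j\<close>. Each such point has a decomposition \<open>ws j\<close>. By the boundedness
  hypothesis a subsequence of these converges, and by outer semicontinuity its limit \<open>w\<close> decomposes
  \<open>u0\<close> at \<open>x0\<close>. The two parts of the union in the theorem correspond to two speeds of convergence. If
  \<open>(ws j - w) /\<^sub>R t j\<close> is bounded, a limit \<open>k\<close> of it decomposes \<open>l\<close>, with base direction \<open>h\<close>. If not,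
  the decompositions move faster than the points, \<open>norm (ws j - w)\<close> is the right step length, and at
  this scale the movement of the points disappears: the direction is \<open>(0, k)\<close> with \<open>k\<close> of norm \<open>1\<close> and
  components adding up to \<open>0\<close>. Both cases are instances of \<open>dir_coderiv_sum_limit\<close>, with different step
  lengths.

  That lemma rests on a sum rule at a single point. The decompositions form the set
  \<open>graph_prod Si \<inter> {z. consensus_gap z = 0}\<close>, where every summand has its own base point and a linear
  equation demands that these agree. A regular normal to the graph of the sum pulls back to a
  regular normal to this set (\<open>regular_normal_mf_sum\<close>). The intersection with the kernel is then
  removed by \<open>regular_normal_cone_Int_kernel\<close>, at the price of an arbitrarily small change of the point
  and of the normal and of a multiplier for the linear equation. The multiplier is bounded in terms of
  the subregularity modulus. What remains is a regular normal to \<open>graph_prod\<close>, which splits into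
  regular normals to the graphs of the summands (\<open>regular_normal_graph_prod\<close>). Since the error can be
  made of smaller order than the step length, the direction survives in the limit, and since the
  multipliers are bounded they have a limit too, whose components are the required summands of the
  coderivative.
\<close>

section \<open>Regular normals\<close>

lemma regular_normal_cone_iff:
  fixes \<Omega> :: "'a::real_inner set"
  shows "\<xi> \<in> regular_normal_cone \<Omega> x \<longleftrightarrow>
    x \<in> \<Omega> \<and> (\<forall>\<epsilon>>0. \<exists>r>0. \<forall>y\<in>\<Omega>. norm (y - x) < r \<longrightarrow> \<xi> \<bullet> (y - x) \<le> \<epsilon> * norm (y - x))"
proof (cases "x \<in> \<Omega>")
  case True
  let ?q = "\<lambda>y. \<xi> \<bullet> (y - x) / norm (y - x)"
  have "\<xi> \<in> regular_normal_cone \<Omega> x \<longleftrightarrow>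
      (\<forall>\<epsilon>::ereal>0. \<forall>\<^sub>F y in at x within \<Omega>. ereal (?q y) < \<epsilon>)"
    using True by (simp add: regular_normal_cone_def Limsup_le_iff)
  also have "\<dots> \<longleftrightarrow> (\<forall>\<epsilon>>0. \<forall>\<^sub>F y in at x within \<Omega>. ?q y < \<epsilon>)"
  proof safe
    fix \<epsilon> :: real
    assume "\<forall>\<epsilon>::ereal>0. \<forall>\<^sub>F y in at x within \<Omega>. ereal (?q y) < \<epsilon>" "\<epsilon> > 0"
    then have "\<forall>\<^sub>F y in at x within \<Omega>. ereal (?q y) < ereal \<epsilon>"
      by (metis ereal_less(2))
    then show "\<forall>\<^sub>F y in at x within \<Omega>. ?q y < \<epsilon>"
      by simp
  next
    fix \<epsilon> :: ereal
    assume *: "\<forall>\<epsilon>>0. \<forall>\<^sub>F y in at x within \<Omega>. ?q y < \<epsilon>" and "\<epsilon> > 0"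
    obtain \<delta> where \<delta>: "0 < ereal \<delta>" "ereal \<delta> < \<epsilon>"
      using ereal_dense2[OF \<open>\<epsilon> > 0\<close>] by auto
    then have "\<forall>\<^sub>F y in at x within \<Omega>. ?q y < \<delta>"
      using * by simp
    then show "\<forall>\<^sub>F y in at x within \<Omega>. ereal (?q y) < \<epsilon>"
      by eventually_elim (metis \<delta>(2) less_trans less_ereal.simps(1))
  qed
  also have "\<dots> \<longleftrightarrow>
      (\<forall>\<epsilon>>0. \<exists>r>0. \<forall>y\<in>\<Omega>. norm (y - x) < r \<longrightarrow> \<xi> \<bullet> (y - x) \<le> \<epsilon> * norm (y - x))"
  proof safe
    fix \<epsilon> :: real
    assume "\<forall>\<epsilon>>0. \<forall>\<^sub>F y in at x within \<Omega>. ?q y < \<epsilon>" "\<epsilon> > 0"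
    then obtain r where r: "r > 0" "\<And>y. y \<in> \<Omega> \<Longrightarrow> y \<noteq> x \<Longrightarrow> dist y x < r \<Longrightarrow> ?q y < \<epsilon>"
      unfolding eventually_at by metis
    have "\<xi> \<bullet> (y - x) \<le> \<epsilon> * norm (y - x)" if "y \<in> \<Omega>" "norm (y - x) < r" for y
      using r(2)[of y] that by (cases "y = x") (auto simp: dist_norm divide_simps less_imp_le)
    then show "\<exists>r>0. \<forall>y\<in>\<Omega>. norm (y - x) < r \<longrightarrow> \<xi> \<bullet> (y - x) \<le> \<epsilon> * norm (y - x)"
      using r(1) by blast
  next
    fix \<epsilon> :: real
    assume *: "\<forall>\<epsilon>>0. \<exists>r>0. \<forall>y\<in>\<Omega>. norm (y - x) < r \<longrightarrow> \<xi> \<bullet> (y - x) \<le> \<epsilon> * norm (y - x)"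
      and "\<epsilon> > 0"
    then obtain r where r: "r > 0"
      "\<And>y. y \<in> \<Omega> \<Longrightarrow> norm (y - x) < r \<Longrightarrow> \<xi> \<bullet> (y - x) \<le> \<epsilon> / 2 * norm (y - x)"
      using half_gt_zero by metis
    have "?q y < \<epsilon>" if "y \<in> \<Omega>" "y \<noteq> x" "dist y x < r" for y
    proof -
      have "?q y \<le> \<epsilon> / 2"
        using r(2)[of y] that by (simp add: dist_norm pos_divide_le_eq)
      also have "\<dots> < \<epsilon>" using \<open>\<epsilon> > 0\<close> by simp
      finally show ?thesis .
    qed
    then show "\<forall>\<^sub>F y in at x within \<Omega>. ?q y < \<epsilon>"
      unfolding eventually_at using r(1) by blast
  qed
  finally show ?thesis using True by simp
qed (simp add: regular_normal_cone_def)

text \<open>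
  Along an affine map \<open>y \<mapsto> z + L (y - x)\<close> taking \<open>G\<close> into \<open>\<Omega>\<close>, the adjoint of \<open>L\<close> carries normals of \<open>\<Omega>\<close>
  back to normals of \<open>G\<close>, because \<open>L\<close> enlarges norms by at most a constant factor. The element \<open>\<xi>\<close> is the
  adjoint image of \<open>\<zeta>\<close>, described by its inner products.
\<close>

lemma regular_normal_cone_pullback:
  fixes L :: "'a::real_inner \<Rightarrow> 'b::real_inner"
  assumes L: "bounded_linear L"
    and maps: "\<And>y. y \<in> G \<Longrightarrow> z + L (y - x) \<in> \<Omega>"
    and x: "x \<in> G"
    and \<zeta>: "\<zeta> \<in> regular_normal_cone \<Omega> z"
    and adj: "\<And>y. \<xi> \<bullet> y = \<zeta> \<bullet> L y"
  shows "\<xi> \<in> regular_normal_cone G x"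
  unfolding regular_normal_cone_iff
proof (intro conjI allI impI x)
  fix \<epsilon> :: real assume "\<epsilon> > 0"
  obtain B where B: "B > 0" "\<And>y. norm (L y) \<le> norm y * B"
    using bounded_linear.pos_bounded[OF L] by blast
  obtain r where r: "r > 0"
    "\<And>y. y \<in> \<Omega> \<Longrightarrow> norm (y - z) < r \<Longrightarrow> \<zeta> \<bullet> (y - z) \<le> \<epsilon> / B * norm (y - z)"
    using \<zeta> \<open>\<epsilon> > 0\<close> B(1) unfolding regular_normal_cone_iff by (meson divide_pos_pos)
  have "\<xi> \<bullet> (y - x) \<le> \<epsilon> * norm (y - x)" if "y \<in> G" "norm (y - x) < r / B" for y
  proof -
    have "norm (y - x) * B < r"
      using that(2) B(1) by (simp add: pos_less_divide_eq)
    then have "\<zeta> \<bullet> L (y - x) \<le> \<epsilon> / B * norm (L (y - x))"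
      using r(2)[OF maps[OF that(1)]] B(2)[of "y - x"] by simp
    also have "\<dots> \<le> \<epsilon> / B * (norm (y - x) * B)"
      using B \<open>\<epsilon> > 0\<close> by (intro mult_left_mono) auto
    finally show ?thesis using B(1) adj by simp
  qed
  then show "\<exists>r>0. \<forall>y\<in>G. norm (y - x) < r \<longrightarrow> \<xi> \<bullet> (y - x) \<le> \<epsilon> * norm (y - x)"
    using r(1) B(1) by (intro exI[of _ "r / B"]) auto
qed

lemma regular_normal_cone_UNIV:
  fixes x :: "'a::real_inner"
  assumes "\<xi> \<in> regular_normal_cone UNIV x"
  shows "\<xi> = 0"
proof (rule ccontr)
  assume "\<xi> \<noteq> 0"
  then obtain r where r: "r > 0"
    "\<And>y. norm (y - x) < r \<Longrightarrow> \<xi> \<bullet> (y - x) \<le> norm \<xi> / 2 * norm (y - x)"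
    using assms unfolding regular_normal_cone_iff
    by (metis half_gt_zero UNIV_I zero_less_norm_iff)
  define s where "s = r / (2 * norm \<xi>)"
  have s: "s > 0" "s * norm \<xi> < r"
    using r(1) \<open>\<xi> \<noteq> 0\<close> by (auto simp: s_def)
  have "s * (norm \<xi>)\<^sup>2 \<le> s * (norm \<xi>)\<^sup>2 / 2"
    using r(2)[of "x + s *\<^sub>R \<xi>"] s by (simp add: dot_square_norm power2_eq_square)
  then show False using s(1) \<open>\<xi> \<noteq> 0\<close> by simp
qed

section \<open>Regular normals to the intersection with a kernel\<close>

text \<open>
  An approximate multiplier rule. The normal \<open>\<xi>\<close> makes \<open>z0\<close> a minimum, up to first-order errors, of
  \<open>- (\<xi> \<bullet> (z - z0))\<close> over the points of \<open>\<Omega>\<close> with \<open>A z = 0\<close>. The quadratic penalty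
  \<open>j / 2 * (norm (A z))\<^sup>2\<close> replaces the equation and \<open>c * (norm (z - z0))\<^sup>2\<close> absorbs the errors, so that
  for large \<open>j\<close> a minimiser over \<open>\<Omega>\<close> in a small ball lies in the interior of the ball. Its first-order
  condition is the last claim, with multiplier \<open>\<eta> = j *\<^sub>R A z\<close>. As \<open>j\<close> is not under control, the bound
  on \<open>\<eta>\<close> comes from subregularity: comparing the minimiser with a feasible point at
  distance at most \<open>\<kappa> * norm (A z)\<close> shows that the penalty \<open>j / 2 * (norm (A z))\<^sup>2\<close> is at most a
  multiple of \<open>norm (A z)\<close>.
\<close>

lemma regular_normal_cone_Int_kernel:
  fixes \<Omega> :: "'a::euclidean_space set" and A :: "'a \<Rightarrow> 'b::euclidean_space"
  assumes A: "linear A" and closed: "closed \<Omega>"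
    and \<xi>: "\<xi> \<in> regular_normal_cone (\<Omega> \<inter> {z. A z = 0}) z0"
    and r: "r > 0" and \<kappa>: "\<kappa> > 0"
    and subreg: "\<And>z. z \<in> \<Omega> \<Longrightarrow> norm (z - z0) \<le> r \<Longrightarrow>
      \<exists>z'\<in>\<Omega>. A z' = 0 \<and> norm (z' - z) \<le> \<kappa> * norm (A z)"
    and \<epsilon>: "\<epsilon> > 0"
  shows "\<exists>z \<eta> e. norm (z - z0) \<le> \<epsilon> \<and> norm \<eta> \<le> 2 * \<kappa> * (norm \<xi> + \<epsilon>) \<and> norm e \<le> \<epsilon> \<and>
    \<xi> - e - adjoint A \<eta> \<in> regular_normal_cone \<Omega> z"
proof -
  interpret A: bounded_linear A
    using A by (simp add: linear_conv_bounded_linear)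
  have z0: "z0 \<in> \<Omega>" "A z0 = 0"
    using \<xi> by (auto simp: regular_normal_cone_iff)
  obtain r1 where r1: "r1 > 0"
    "\<And>z. z \<in> \<Omega> \<Longrightarrow> A z = 0 \<Longrightarrow> norm (z - z0) < r1 \<Longrightarrow>
      \<xi> \<bullet> (z - z0) \<le> \<epsilon> / 8 * norm (z - z0)"
  proof -
    have "\<epsilon> / 8 > 0"
      using \<epsilon> by simp
    with \<xi> show ?thesis
      using that unfolding regular_normal_cone_iff by blast
  qed
  define s where "s = min (min r \<epsilon>) (r1 / 2)"
  have s: "s > 0" "s \<le> r" "s \<le> \<epsilon>" "s < r1"
    using r \<epsilon> r1(1) by (auto simp: s_def)
  (* With this c the gradient 2 * c * (z - z0) of the quadratic term is at most \<epsilon> on the ball of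
     radius s, while feasible points with nonpositive value are within s / 4 of z0. *)
  define c where "c = \<epsilon> / (2 * s)"
  have c: "c > 0" "2 * c * s = \<epsilon>"
    using s \<epsilon> by (auto simp: c_def)
  define K where "K = \<Omega> \<inter> cball z0 s"
  have K: "compact K" "z0 \<in> K"
    using closed s z0 by (auto simp: K_def closed_Int_compact)
  have KD: "z \<in> \<Omega>" "norm (z - z0) \<le> s" if "z \<in> K" for z
    using that by (auto simp: K_def dist_norm norm_minus_commute)
  have KI: "z \<in> K" if "z \<in> \<Omega>" "norm (z - z0) \<le> s" for z
    using that by (auto simp: K_def dist_norm norm_minus_commute)
  define f where "f j z = - (\<xi> \<bullet> (z - z0)) + c * (norm (z - z0))\<^sup>2 + j / 2 * (norm (A z))\<^sup>2"
    for j :: real and z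
  have "\<exists>z\<in>K. \<forall>y\<in>K. f (real j) z \<le> f (real j) y" for j
    unfolding f_def using K
    by (intro continuous_attains_inf)
       (auto intro!: continuous_intros A.continuous_on)
  then obtain q where q: "\<And>j. q j \<in> K" "\<And>j y. y \<in> K \<Longrightarrow> f (real j) (q j) \<le> f (real j) y"
    by metis
  obtain p \<sigma> where p: "p \<in> K" "strict_mono (\<sigma> :: nat \<Rightarrow> nat)" "(q \<circ> \<sigma>) \<longlonglongrightarrow> p"
    using K(1) q(1) unfolding compact_def by metis
  have q0: "- (\<xi> \<bullet> (q j - z0)) + c * (norm (q j - z0))\<^sup>2 + real j / 2 * (norm (A (q j)))\<^sup>2 \<le> 0" for j
    using q(2)[OF K(2), of j] z0 by (simp add: f_def)
  have p3: "(\<lambda>j. q (\<sigma> j)) \<longlonglongrightarrow> p"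
    using p(3) by (simp add: o_def)
  have Aq: "(\<lambda>j. A (q (\<sigma> j))) \<longlonglongrightarrow> A p"
    by (rule A.tendsto[OF p3])
  have Ap: "A p = 0"
  proof -
    have le: "(norm (A (q j)))\<^sup>2 \<le> 2 * norm \<xi> * s * inverse (real j)" if "j > 0" for j
    proof -
      have "\<xi> \<bullet> (q j - z0) \<le> norm \<xi> * s"
        using norm_cauchy_schwarz[of \<xi> "q j - z0"] KD(2)[OF q(1)[of j]]
          mult_left_mono[of "norm (q j - z0)" s "norm \<xi>"] by fastforce
      moreover have "c * (norm (q j - z0))\<^sup>2 \<ge> 0"
        using c by simp
      ultimately have "real j / 2 * (norm (A (q j)))\<^sup>2 \<le> norm \<xi> * s"
        using q0[of j] by linarith
      then show ?thesis using that by (simp add: field_simps)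
    qed
    have "(\<lambda>j. 2 * norm \<xi> * s * inverse (real (\<sigma> j))) \<longlonglongrightarrow> 2 * norm \<xi> * s * 0"
      using LIMSEQ_subseq_LIMSEQ[OF lim_inverse_n p(2)] by (intro tendsto_intros) (simp add: o_def)
    moreover have "(\<lambda>j. (norm (A (q (\<sigma> j))))\<^sup>2) \<longlonglongrightarrow> (norm (A p))\<^sup>2"
      by (intro tendsto_intros Aq)
    moreover have "(norm (A (q (\<sigma> j))))\<^sup>2 \<le> 2 * norm \<xi> * s * inverse (real (\<sigma> j))" if "j \<ge> 1" for j
      using le[of "\<sigma> j"] that seq_suble[OF p(2), of j] by linarith
    ultimately have "(norm (A p))\<^sup>2 \<le> 2 * norm \<xi> * s * 0"
      by (intro LIMSEQ_le) auto
    then show ?thesis by simp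
  qed
  have "norm (p - z0) < s / 2"
  proof -
    have "(\<lambda>j. - (\<xi> \<bullet> (q (\<sigma> j) - z0)) + c * (norm (q (\<sigma> j) - z0))\<^sup>2)
        \<longlonglongrightarrow> - (\<xi> \<bullet> (p - z0)) + c * (norm (p - z0))\<^sup>2"
      by (intro tendsto_intros p3)
    moreover have "- (\<xi> \<bullet> (q j - z0)) + c * (norm (q j - z0))\<^sup>2 \<le> 0" for j
      using q0[of j] by (smt (verit) divide_nonneg_nonneg mult_nonneg_nonneg of_nat_0_le_iff zero_le_power2)
    ultimately have "- (\<xi> \<bullet> (p - z0)) + c * (norm (p - z0))\<^sup>2 \<le> 0"
      by (intro LIMSEQ_le_const2) auto
    moreover have "\<xi> \<bullet> (p - z0) \<le> \<epsilon> / 8 * norm (p - z0)"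
      using r1(2) Ap KD[OF p(1)] s by auto
    ultimately have *: "c * (norm (p - z0))\<^sup>2 \<le> \<epsilon> / 8 * norm (p - z0)"
      by linarith
    show ?thesis
    proof (cases "p = z0")
      case False
      then have "c * norm (p - z0) \<le> \<epsilon> / 8"
        using * by (simp add: power2_eq_square mult.assoc[symmetric])
      also have "\<dots> = c * (s / 4)"
        using c by simp
      finally have "norm (p - z0) \<le> s / 4"
        using c(1) by simp
      then show ?thesis using s by linarith
    qed (use s in auto)
  qed
  then have "\<forall>\<^sub>F j in sequentially. norm (q (\<sigma> j) - z0) < s / 2"
    using p3 by (intro order_tendstoD(2)[of _ "norm (p - z0)"] tendsto_intros)
  moreover have "\<forall>\<^sub>F j in sequentially. \<kappa> * norm (A (q (\<sigma> j))) < s / 2"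
    using Aq s Ap by (intro order_tendstoD(2)[of _ "\<kappa> * norm (A p)"] tendsto_intros) auto
  ultimately have "\<forall>\<^sub>F j in sequentially.
      norm (q (\<sigma> j) - z0) < s / 2 \<and> \<kappa> * norm (A (q (\<sigma> j))) < s / 2"
    by (rule eventually_conj)
  then obtain j where j: "norm (q j - z0) < s / 2" "\<kappa> * norm (A (q j)) < s / 2"
    by (auto simp: eventually_sequentially)
  define z where "z = q j"
  define \<eta> where "\<eta> = real j *\<^sub>R A z"
  define e where "e = (2 * c) *\<^sub>R (z - z0)"
  have z: "z \<in> K" "norm (z - z0) < s / 2" "\<kappa> * norm (A z) < s / 2"
    using q(1) j by (auto simp: z_def)
  have min: "f (real j) z \<le> f (real j) y" if "y \<in> K" for y
    using q(2) that by (simp add: z_def)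
  have "norm e \<le> \<epsilon>"
  proof -
    have "norm e \<le> 2 * c * s"
      using c z s unfolding e_def norm_scaleR by (intro mult_mono) auto
    then show ?thesis using c by simp
  qed
  moreover have "norm \<eta> \<le> 2 * \<kappa> * (norm \<xi> + \<epsilon>)"
  proof (cases "A z = 0")
    case True
    then show ?thesis using \<kappa> \<epsilon> by (simp add: \<eta>_def)
  next
    case False
    obtain z' where z': "z' \<in> \<Omega>" "A z' = 0" "norm (z' - z) \<le> \<kappa> * norm (A z)"
      using subreg[of z] KD[OF z(1)] s by auto
    have z'0: "norm (z' - z0) \<le> s"
      using z' z norm_triangle_ineq[of "z' - z" "z - z0"] by simp
    have "real j / 2 * (norm (A z))\<^sup>2
        \<le> \<xi> \<bullet> (z - z') + c * ((norm (z' - z0))\<^sup>2 - (norm (z - z0))\<^sup>2)"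
      using min[OF KI[OF z'(1) z'0]] z'(2) by (simp add: f_def algebra_simps)
    also have "\<dots> \<le> norm \<xi> * norm (z' - z) + c * (norm (z' - z) * (2 * s))"
    proof (intro add_mono mult_left_mono)
      show "\<xi> \<bullet> (z - z') \<le> norm \<xi> * norm (z' - z)"
        using norm_cauchy_schwarz[of \<xi> "z - z'"] by (simp add: norm_minus_commute)
      have "(norm (z' - z0))\<^sup>2 - (norm (z - z0))\<^sup>2
          = (norm (z' - z0) - norm (z - z0)) * (norm (z' - z0) + norm (z - z0))"
        by (simp add: power2_eq_square algebra_simps)
      also have "\<dots> \<le> norm (z' - z) * (2 * s)"
        using norm_triangle_ineq2[of "z' - z0" "z - z0"] z'0 z(2) s
        by (intro mult_mono) auto
      finally show "(norm (z' - z0))\<^sup>2 - (norm (z - z0))\<^sup>2 \<le> norm (z' - z) * (2 * s)" .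
    qed (use c in auto)
    also have "\<dots> = norm (z' - z) * (norm \<xi> + \<epsilon>)"
      using c(2) by (simp add: algebra_simps)
    also have "\<dots> \<le> \<kappa> * norm (A z) * (norm \<xi> + \<epsilon>)"
      using z' \<epsilon> by (intro mult_right_mono) auto
    finally have "(real j * norm (A z)) * norm (A z) \<le> (2 * \<kappa> * (norm \<xi> + \<epsilon>)) * norm (A z)"
      by (simp add: power2_eq_square algebra_simps)
    then show ?thesis
      using False by (simp add: \<eta>_def)
  qed
  moreover have "\<xi> - e - adjoint A \<eta> \<in> regular_normal_cone \<Omega> z"
    unfolding regular_normal_cone_iff
  proof (intro conjI allI impI)
    show "z \<in> \<Omega>" using KD z by auto
    fix \<epsilon>' :: real assume \<epsilon>': "\<epsilon>' > 0"
    obtain B where B: "B > 0" "\<And>y. norm (A y) \<le> norm y * B"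
      using A.pos_bounded by blast
    define M where "M = c + real j / 2 * B\<^sup>2"
    have M: "M > 0" using c by (simp add: M_def add_pos_nonneg)
    have "(\<xi> - e - adjoint A \<eta>) \<bullet> (y - z) \<le> \<epsilon>' * norm (y - z)"
      if y: "y \<in> \<Omega>" "norm (y - z) < min (s / 2) (\<epsilon>' / M)" for y
    proof -
      define d where "d = y - z"
      have yd: "y = z + d" by (simp add: d_def)
      have "norm (y - z0) \<le> s"
        using y z norm_triangle_ineq[of "y - z" "z - z0"] by simp
      then have "f (real j) z \<le> f (real j) y"
        using min KI y by blast
      then have "\<xi> \<bullet> d - e \<bullet> d - \<eta> \<bullet> A d \<le> c * (norm d)\<^sup>2 + real j / 2 * (norm (A d))\<^sup>2"
        unfolding yd f_def power2_norm_eq_inner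
        by (simp add: A.add e_def \<eta>_def algebra_simps inner_simps inner_commute)
      also have "\<dots> \<le> c * (norm d)\<^sup>2 + real j / 2 * (norm d * B)\<^sup>2"
        using B by (intro add_left_mono mult_left_mono power_mono) auto
      also have "\<dots> = M * norm d * norm d"
        by (simp add: M_def power2_eq_square algebra_simps)
      also have "\<dots> \<le> \<epsilon>' * norm d"
        using y M by (intro mult_right_mono) (auto simp: d_def field_simps)
      finally have "\<xi> \<bullet> d - e \<bullet> d - \<eta> \<bullet> A d \<le> \<epsilon>' * norm d" .
      moreover have "adjoint A \<eta> \<bullet> d = \<eta> \<bullet> A d"
        using adjoint_works[OF A, of d \<eta>] by (simp add: inner_commute)
      ultimately show ?thesis
        by (simp only: d_def[symmetric] inner_diff_left)
    qed
    then show "\<exists>r>0. \<forall>y\<in>\<Omega>. norm (y - z) < r \<longrightarrow>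
        (\<xi> - e - adjoint A \<eta>) \<bullet> (y - z) \<le> \<epsilon>' * norm (y - z)"
      using s M \<epsilon>' by (intro exI[of _ "min (s / 2) (\<epsilon>' / M)"]) auto
  qed
  moreover have "norm (z - z0) \<le> \<epsilon>"
    using z s by simp
  ultimately show ?thesis by blast
qed

section \<open>Directional neighborhoods\<close>

text \<open>
  For \<open>d \<noteq> 0\<close> the inequality that defines a basic directional neighborhood is invariant under positive
  scaling of \<open>z\<close> and strict at \<open>z = d\<close>, so it is strict at \<open>t j *\<^sub>R D j\<close> for large \<open>j\<close>. For \<open>d = 0\<close> it is
  void and the neighborhood is a ball. Interior membership is needed because the minimisation in
  \<open>regular_normal_cone_Int_kernel\<close> takes place on a full ball.
\<close>

lemma dir_nbhd_eventually_interior: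
  fixes d :: "'a::real_normed_vector"
  assumes U: "dir_nbhd d U"
    and t: "\<And>j. t j > 0" "t \<longlonglongrightarrow> (0::real)" and D: "D \<longlonglongrightarrow> d"
  shows "\<forall>\<^sub>F j in sequentially. t j *\<^sub>R D j \<in> interior U"
proof -
  obtain \<rho> \<delta> where \<rho>: "\<rho> > 0" and \<delta>: "\<delta> > 0" and sub: "basic_dir_nbhd \<rho> \<delta> d \<subseteq> U"
    using U by (auto simp: dir_nbhd_def)
  have "(\<lambda>j. norm (t j *\<^sub>R D j)) \<longlonglongrightarrow> norm (0 *\<^sub>R d)"
    by (intro tendsto_intros t D)
  then have small: "\<forall>\<^sub>F j in sequentially. norm (t j *\<^sub>R D j) < \<rho>"
    using \<rho> by (intro order_tendstoD(2)) auto
  show ?thesis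
  proof (cases "d = 0")
    case True
    then have "ball 0 \<rho> \<subseteq> U"
      using sub by (auto simp: basic_dir_nbhd_def)
    then have "ball 0 \<rho> \<subseteq> interior U"
      by (simp add: interior_maximal)
    with small show ?thesis
      by (auto elim!: eventually_mono)
  next
    case False
    define V where "V = {z. norm z < \<rho> \<and> norm (norm d *\<^sub>R z - norm z *\<^sub>R d) < \<delta> * norm z * norm d}"
    have "open V"
      unfolding V_def by (intro open_Collect_conj open_Collect_less continuous_intros)
    moreover have "V \<subseteq> U"
      using sub by (auto simp: V_def basic_dir_nbhd_def)
    ultimately have V: "V \<subseteq> interior U"
      by (simp add: interior_maximal)
    have "(\<lambda>j. \<delta> * norm (D j) * norm d - norm (norm d *\<^sub>R D j - norm (D j) *\<^sub>R d))
        \<longlonglongrightarrow> \<delta> * norm d * norm d - norm (norm d *\<^sub>R d - norm d *\<^sub>R d)"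
      by (intro tendsto_intros D)
    then have "\<forall>\<^sub>F j in sequentially.
        0 < \<delta> * norm (D j) * norm d - norm (norm d *\<^sub>R D j - norm (D j) *\<^sub>R d)"
      by (rule order_tendstoD(1)) (use \<delta> False in auto)
    with small have "\<forall>\<^sub>F j in sequentially. t j *\<^sub>R D j \<in> V"
    proof eventually_elim
      case (elim j)
      have "norm d *\<^sub>R (t j *\<^sub>R D j) - norm (t j *\<^sub>R D j) *\<^sub>R d
          = t j *\<^sub>R (norm d *\<^sub>R D j - norm (D j) *\<^sub>R d)"
        using t(1)[of j] by (simp add: algebra_simps)
      then have "norm (norm d *\<^sub>R (t j *\<^sub>R D j) - norm (t j *\<^sub>R D j) *\<^sub>R d)
          = t j * norm (norm d *\<^sub>R D j - norm (D j) *\<^sub>R d)"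
        using t(1)[of j] by simp
      also have "\<dots> < t j * (\<delta> * norm (D j) * norm d)"
        using elim t(1)[of j] by (intro mult_strict_left_mono) auto
      finally show ?case
        using elim(1) t(1)[of j] by (simp add: V_def mult.assoc mult.left_commute)
    qed
    then show ?thesis
      using V by (auto elim!: eventually_mono)
  qed
qed

section \<open>The sum constraint\<close>

definition graph_prod ::
    "('p::finite \<Rightarrow> ('a, 'b) multifun) \<Rightarrow> ('a \<times> ('a ^ 'p) \<times> ('b ^ 'p)) set" where
  "graph_prod Si = {(x, v, w). \<forall>i. (v $ i, w $ i) \<in> gph (Si i)}"

text \<open>
  The first block of \<open>sum_constraint\<close>, measuring how far the individual base points \<open>v $ i\<close> are from
  the common one.
\<close>

definition consensus_gap :: "'a::ab_group_add \<times> ('a ^ 'p::finite) \<times> 'c \<Rightarrow> 'a ^ 'p" where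
  "consensus_gap z = (\<chi> i. fst z) - fst (snd z)"

lemma closed_graph_prod:
  fixes Si :: "'p::finite \<Rightarrow> ('a::topological_space, 'b::topological_space) multifun"
  assumes "\<And>i. outer_semicontinuous (Si i)"
  shows "closed (graph_prod Si)"
proof -
  have "closed ((\<lambda>z. (fst (snd z) $ i, snd (snd z) $ i)) -` gph (Si i) ::
      ('a \<times> ('a ^ 'p) \<times> ('b ^ 'p)) set)" for i
    using assms unfolding outer_semicontinuous_def
    by (intro closed_vimage) (auto intro!: continuous_intros)
  moreover have "graph_prod Si =
      (\<Inter>i. (\<lambda>z. (fst (snd z) $ i, snd (snd z) $ i)) -` gph (Si i))"
    by (auto simp: graph_prod_def)
  ultimately show ?thesis by auto
qed

lemma linear_consensus_gap:
  "linear (consensus_gap :: 'a::real_vector \<times> ('a ^ 'p::finite) \<times> 'c::real_vector \<Rightarrow> 'a ^ 'p)"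
  by (rule linearI) (auto simp: consensus_gap_def vec_eq_iff algebra_simps)

lemma adjoint_consensus_gap:
  "adjoint (consensus_gap :: 'a::euclidean_space \<times> ('a ^ 'p::finite) \<times> 'c::euclidean_space \<Rightarrow> _) \<eta> =
    (\<Sum>i\<in>UNIV. \<eta> $ i, - \<eta>, 0)"
proof -
  have "adjoint (consensus_gap :: 'a \<times> ('a ^ 'p) \<times> 'c \<Rightarrow> _) = (\<lambda>\<eta>. (\<Sum>i\<in>UNIV. \<eta> $ i, - \<eta>, 0))"
    by (rule adjoint_unique)
       (auto simp: consensus_gap_def inner_Pair inner_vec_def inner_diff_left inner_sum_right
          sum_subtractf sum_negf)
  then show ?thesis by simp
qed

text \<open>
  The residual of \<open>sum_constraint\<close> at a point of \<open>graph_prod\<close> is the consensus gap alone. So the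
  zero set of the constraint is the part of \<open>graph_prod\<close> in the kernel of the gap, and there the
  distance from \<open>0\<close> to the values of the constraint is at most the norm of the gap.
\<close>

lemma mem_sum_constraint_iff:
  fixes Si :: "'p::finite \<Rightarrow> ('a::real_normed_vector, 'b::real_normed_vector) multifun"
  shows "(g, 0) \<in> sum_constraint Si z \<longleftrightarrow> g = consensus_gap z \<and> z \<in> graph_prod Si"
proof -
  have "0 \<in> (\<lambda>y. y - c) ` G \<longleftrightarrow> c \<in> G" for c and G :: "('a \<times> 'b) set"
    by (auto simp: image_iff)
  then show ?thesis
    by (cases z) (simp add: sum_constraint_def graph_prod_def consensus_gap_def)
qed

lemma sum_constraint_inverse_zero:
  fixes Si :: "'p::finite \<Rightarrow> ('a::real_normed_vector, 'b::real_normed_vector) multifun"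
  shows "mf_inverse (sum_constraint Si) 0 = graph_prod Si \<inter> {z. consensus_gap z = 0}"
proof -
  have "0 \<in> sum_constraint Si z \<longleftrightarrow> (0, 0) \<in> sum_constraint Si z" for z
    by (simp only: zero_prod_def)
  then show ?thesis
    unfolding mf_inverse_def by (auto simp: mem_sum_constraint_iff)
qed

section \<open>Regular normals to the graph of a sum\<close>

lemma gph_mf_sum:
  fixes Si :: "'p::finite \<Rightarrow> ('a, 'b::comm_monoid_add) multifun"
  shows "z \<in> gph (mf_sum Si) \<longleftrightarrow> sum_decomp Si z \<noteq> {}"
proof -
  obtain x u where z: "z = (x, u)" by (cases z)
  have "u \<in> mf_sum Si x \<longleftrightarrow> (\<exists>s. u = sum s UNIV \<and> (\<forall>i. s i \<in> Si i x))"
    by (simp add: mf_sum_def set_sum_alt)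
  also have "\<dots> \<longleftrightarrow> (\<exists>w. w \<in> sum_decomp Si (x, u))"
  proof safe
    fix s assume "\<forall>i. s i \<in> Si i x" "u = sum s UNIV"
    then have "(\<chi> i. s i) \<in> sum_decomp Si (x, sum s UNIV)"
      by (simp add: sum_decomp_def)
    then show "\<exists>w. w \<in> sum_decomp Si (x, sum s UNIV)" ..
  next
    fix w assume "w \<in> sum_decomp Si (x, u)"
    then show "\<exists>s. u = sum s UNIV \<and> (\<forall>i. s i \<in> Si i x)"
      by (intro exI[of _ "\<lambda>i. w $ i"]) (auto simp: sum_decomp_def)
  qed
  finally show ?thesis by (auto simp: z gph_def)
qed

text \<open>
  A point of the zero set of the sum constraint consists of a base point \<open>x\<close>, copies of \<open>x\<close> and a
  decomposition of an element of the sum at \<open>x\<close>. Adding up the decomposition is a linear map from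
  this zero set into the graph of the sum, and regular normals pull back along it.
\<close>

lemma regular_normal_mf_sum:
  fixes Si :: "'p::finite \<Rightarrow> ('a::euclidean_space, 'b::euclidean_space) multifun"
  assumes w: "w \<in> sum_decomp Si (x, u)"
    and nrm: "(x', - u') \<in> regular_normal_cone (gph (mf_sum Si)) (x, u)"
  shows "(x', 0, \<chi> i. - u') \<in>
    regular_normal_cone (graph_prod Si \<inter> {z. consensus_gap z = 0}) (x, \<chi> i. x, w)"
proof (rule regular_normal_cone_pullback[OF _ _ _ nrm])
  let ?L = "\<lambda>z::'a \<times> ('a ^ 'p) \<times> ('b ^ 'p). (fst z, \<Sum>i\<in>UNIV. snd (snd z) $ i)"
  show "bounded_linear ?L"
    unfolding linear_conv_bounded_linear[symmetric]
    by (rule linearI) (auto simp: sum.distrib scaleR_sum_right)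
  show "(x', 0, \<chi> i. - u') \<bullet> y = (x', - u') \<bullet> ?L y" for y
    by (cases y) (simp add: inner_vec_def inner_sum_right)
  show "(x, u) + ?L (y - (x, \<chi> i. x, w)) \<in> gph (mf_sum Si)"
    if y: "y \<in> graph_prod Si \<inter> {z. consensus_gap z = 0}" for y
  proof -
    obtain a b c where abc: "y = (a, b, c)" by (cases y)
    have "c \<in> sum_decomp Si (a, \<Sum>i\<in>UNIV. c $ i)"
      using y by (auto simp: abc graph_prod_def consensus_gap_def sum_decomp_def gph_def)
    moreover have "(x, u) + ?L (y - (x, \<chi> i. x, w)) = (a, \<Sum>i\<in>UNIV. c $ i)"
      using w by (auto simp: abc sum_decomp_def sum_subtractf)
    ultimately show ?thesis
      by (auto simp: gph_mf_sum)
  qed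
  show "(x, \<chi> i. x, w) \<in> graph_prod Si \<inter> {z. consensus_gap z = 0}"
    using w by (auto simp: graph_prod_def consensus_gap_def sum_decomp_def gph_def vec_eq_iff)
qed

text \<open>
  In \<open>graph_prod\<close> the base point is unrestricted, which forces the first component of a normal to
  vanish; every other pair of components may be varied inside its own graph with the rest kept fixed.
\<close>

lemma regular_normal_graph_prod:
  fixes Si :: "'p::finite \<Rightarrow> ('a::euclidean_space, 'b::euclidean_space) multifun"
  assumes nrm: "(a, b, c) \<in> regular_normal_cone (graph_prod Si) (x, v, w)"
  shows "a = 0" and "(b $ i, c $ i) \<in> regular_normal_cone (gph (Si i)) (v $ i, w $ i)"
proof -
  have mem: "(x, v, w) \<in> graph_prod Si"
    using nrm by (simp add: regular_normal_cone_iff)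
  have "a \<in> regular_normal_cone UNIV x"
    by (rule regular_normal_cone_pullback[OF _ _ _ nrm, where L = "\<lambda>y. (y, 0, 0)"])
       (use mem in \<open>auto simp: graph_prod_def intro!: bounded_linear_intros bounded_linear_Pair\<close>)
  then show "a = 0"
    by (rule regular_normal_cone_UNIV)
  let ?L = "\<lambda>y. (0, axis i (fst y), axis i (snd y)) :: 'a \<times> ('a ^ 'p) \<times> ('b ^ 'p)"
  show "(b $ i, c $ i) \<in> regular_normal_cone (gph (Si i)) (v $ i, w $ i)"
  proof (rule regular_normal_cone_pullback[OF _ _ _ nrm])
    show "bounded_linear ?L"
      unfolding linear_conv_bounded_linear[symmetric]
      by (rule linearI) (auto simp: axis_def vec_eq_iff)
    show "(x, v, w) + ?L (y - (v $ i, w $ i)) \<in> graph_prod Si" if "y \<in> gph (Si i)" for y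
      using mem that by (cases y) (auto simp: graph_prod_def axis_def)
    show "(b $ i, c $ i) \<bullet> y = (a, b, c) \<bullet> ?L y" for y
      by (cases y) (simp add: inner_axis)
    show "(v $ i, w $ i) \<in> gph (Si i)"
      using mem by (simp add: graph_prod_def)
  qed
qed

text \<open>
  Subregularity of the sum constraint in the form in which \<open>regular_normal_cone_Int_kernel\<close> takes it.
  The distance is an infimum that need not be attained; doubling the modulus makes up for that where
  the gap is nonzero, and where it vanishes the point itself is admissible.
\<close>

lemma sum_constraint_subregular_near:
  fixes Si :: "'p::finite \<Rightarrow> ('a::euclidean_space, 'b::euclidean_space) multifun"
  assumes "dir_metrically_subregular (sum_constraint Si) (z0, 0) d"
  obtains \<kappa> U where "\<kappa> > 0" "dir_nbhd d U"
    "\<And>z. z \<in> graph_prod Si \<Longrightarrow> z - z0 \<in> U \<Longrightarrow>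
      \<exists>z'\<in>graph_prod Si. consensus_gap z' = 0 \<and> norm (z' - z) \<le> \<kappa> * norm (consensus_gap z)"
proof -
  let ?F = "sum_constraint Si"
  obtain \<kappa> U where \<kappa>: "\<kappa> > 0" "dir_nbhd d U"
    and le: "\<And>z. z \<in> (+) z0 ` U \<Longrightarrow> dist_to (mf_inverse ?F 0) z \<le> ereal \<kappa> * dist_to (?F z) 0"
    using assms unfolding dir_metrically_subregular_def prod.case by blast
  have "\<exists>z'\<in>graph_prod Si. consensus_gap z' = 0 \<and> norm (z' - z) \<le> 2 * \<kappa> * norm (consensus_gap z)"
    if z: "z \<in> graph_prod Si" "z - z0 \<in> U" for z
  proof (cases "consensus_gap z = 0")
    case True
    then show ?thesis using z by (intro bexI[of _ z]) auto
  next
    case False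
    have "(consensus_gap z, 0) \<in> ?F z"
      using z(1) by (simp add: mem_sum_constraint_iff)
    then have "dist_to (?F z) 0 \<le> ereal (dist 0 (consensus_gap z, 0::('a \<times> 'b) ^ 'p))"
      unfolding dist_to_def by (intro INF_lower)
    also have "\<dots> = ereal (norm (consensus_gap z))"
      by (simp add: dist_norm norm_Pair)
    finally have "ereal \<kappa> * dist_to (?F z) 0 \<le> ereal \<kappa> * ereal (norm (consensus_gap z))"
      using \<kappa> by (intro ereal_mult_left_mono) auto
    moreover have "z \<in> (+) z0 ` U"
      using z(2) by (intro image_eqI[of _ _ "z - z0"]) auto
    ultimately have "dist_to (mf_inverse ?F 0) z \<le> ereal (\<kappa> * norm (consensus_gap z))"
      using le[of z] by (auto intro: order_trans)
    also have "\<dots> < ereal (2 * \<kappa> * norm (consensus_gap z))"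
      using \<kappa> False by simp
    finally obtain z' where "z' \<in> mf_inverse ?F 0" "dist z z' < 2 * \<kappa> * norm (consensus_gap z)"
      unfolding dist_to_def by (auto simp: INF_less_iff)
    then show ?thesis
      unfolding sum_constraint_inverse_zero
      by (intro bexI[of _ z']) (auto simp: dist_norm norm_minus_commute)
  qed
  then show thesis
    using that[of "2 * \<kappa>" U] \<kappa> by auto
qed

text \<open>
  For \<open>graph_prod\<close> and the consensus gap, \<open>regular_normal_cone_Int_kernel\<close> becomes an approximate sum
  rule at a single point. The adjoint of the gap sends the multiplier \<open>\<eta>\<close> to \<open>(\<Sum>i. \<eta> $ i, - \<eta>, 0)\<close>:
  the vanishing first component of the perturbed normal says that the \<open>\<eta> $ i\<close> add up to nearly
  \<open>x'\<close>, and its remaining components say that \<open>(\<eta> $ i, - u')\<close> is nearly normal to the graph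
  of \<open>Si i\<close>. The bound on \<open>b\<close> is what later gives convergent subsequences.
\<close>

lemma fuzzy_sum_rule:
  fixes Si :: "'p::finite \<Rightarrow> ('a::euclidean_space, 'b::euclidean_space) multifun"
    and \<epsilon> :: real
  assumes osc: "\<And>i. outer_semicontinuous (Si i)"
    and w: "w \<in> sum_decomp Si (x, u)"
    and nrm: "(x', - u') \<in> regular_normal_cone (gph (mf_sum Si)) (x, u)"
    and r: "r > 0" and \<kappa>: "\<kappa> > 0"
    and subreg: "\<And>z. z \<in> graph_prod Si \<Longrightarrow> norm (z - (x, (\<chi> i. x), w)) \<le> r \<Longrightarrow>
      \<exists>z'\<in>graph_prod Si. consensus_gap z' = 0 \<and> norm (z' - z) \<le> \<kappa> * norm (consensus_gap z)"
    and \<epsilon>: "\<epsilon> > 0"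
  shows "\<exists>v w' b c. norm (v - (\<chi> i. x)) \<le> \<epsilon> \<and> norm (w' - w) \<le> \<epsilon> \<and>
    norm b \<le> 2 * \<kappa> * (norm (x', 0::'a ^ 'p, (\<chi> i. - u') :: 'b ^ 'p) + \<epsilon>) + \<epsilon> \<and>
    norm ((\<Sum>i\<in>UNIV. b $ i) - x') \<le> (1 + real CARD('p)) * \<epsilon> \<and> norm (c - (\<chi> i. - u')) \<le> \<epsilon> \<and>
    (\<forall>i. (b $ i, c $ i) \<in> regular_normal_cone (gph (Si i)) (v $ i, w' $ i))"
proof -
  let ?\<xi> = "(x', 0::'a ^ 'p, (\<chi> i. - u') :: 'b ^ 'p)"
  have closed: "closed (graph_prod Si)"
    by (rule closed_graph_prod) (rule osc)
  obtain z \<eta> e where z: "norm (z - (x, (\<chi> i. x), w)) \<le> \<epsilon>"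
    and \<eta>: "norm \<eta> \<le> 2 * \<kappa> * (norm ?\<xi> + \<epsilon>)" and e: "norm e \<le> \<epsilon>"
    and \<zeta>: "?\<xi> - e - adjoint consensus_gap \<eta> \<in> regular_normal_cone (graph_prod Si) z"
    using regular_normal_cone_Int_kernel[OF linear_consensus_gap closed
        regular_normal_mf_sum[OF w nrm] r \<kappa> subreg \<epsilon>] by blast
  obtain y v w' where zD: "z = (y, v, w')" by (cases z)
  obtain e1 e2 e3 where eD: "e = (e1, e2, e3)" by (cases e)
  have vw: "norm (v - (\<chi> i. x)) \<le> \<epsilon>" "norm (w' - w) \<le> \<epsilon>"
    using z norm_snd_le[of "(v - (\<chi> i. x), w' - w)" "y - x"]
      norm_fst_le[of "v - (\<chi> i. x)" "w' - w"] norm_snd_le[of "w' - w" "v - (\<chi> i. x)"]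
    by (auto simp: zD)
  have e123: "norm e1 \<le> \<epsilon>" "norm e2 \<le> \<epsilon>" "norm e3 \<le> \<epsilon>"
    using e norm_fst_le[of e1 "(e2, e3)"] norm_snd_le[of "(e2, e3)" e1]
      norm_fst_le[of e2 e3] norm_snd_le[of e3 e2]
    by (auto simp: eD)
  define b where "b = \<eta> - e2"
  define c where "c = (\<chi> i. - u') - e3"
  have "?\<xi> - e - adjoint consensus_gap \<eta> = (x' - e1 - (\<Sum>i\<in>UNIV. \<eta> $ i), b, c)"
    by (simp add: adjoint_consensus_gap eD b_def c_def)
  with \<zeta> have nrm': "(x' - e1 - (\<Sum>i\<in>UNIV. \<eta> $ i), b, c) \<in> regular_normal_cone (graph_prod Si) (y, v, w')"
    by (simp add: zD)
  have "norm b \<le> 2 * \<kappa> * (norm ?\<xi> + \<epsilon>) + \<epsilon>"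
    using \<eta> e123 norm_triangle_ineq4[of \<eta> e2] by (simp add: b_def)
  moreover have "norm ((\<Sum>i\<in>UNIV. b $ i) - x') \<le> (1 + real CARD('p)) * \<epsilon>"
  proof -
    have "(\<Sum>i\<in>UNIV. b $ i) - x' = - (e1 + (\<Sum>i\<in>UNIV. e2 $ i))"
      using regular_normal_graph_prod(1)[OF nrm'] by (simp add: b_def sum_subtractf algebra_simps)
    moreover have "norm (\<Sum>i\<in>UNIV. e2 $ i) \<le> (\<Sum>i\<in>(UNIV::'p set). \<epsilon>)"
      using e123 Finite_Cartesian_Product.norm_nth_le[of e2] by (intro sum_norm_le) (auto intro: order_trans)
    ultimately show ?thesis
      using e123 norm_triangle_ineq[of e1 "\<Sum>i\<in>UNIV. e2 $ i"] by (simp only: norm_minus_cancel) (simp add: algebra_simps)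
  qed
  moreover have "norm (c - (\<chi> i. - u')) \<le> \<epsilon>"
    using e123 by (simp add: c_def)
  ultimately show ?thesis
    using vw regular_normal_graph_prod(2)[OF nrm'] by blast
qed

section \<open>Limits along decompositions\<close>

lemma sum_decomp_limit:
  fixes Si :: "'p::finite \<Rightarrow> ('a::euclidean_space, 'b::euclidean_space) multifun"
  assumes osc: "\<And>i. outer_semicontinuous (Si i)"
    and dec: "\<And>j. ws j \<in> sum_decomp Si (xs j, us j)"
    and lim: "xs \<longlonglongrightarrow> x" "us \<longlonglongrightarrow> u" "ws \<longlonglongrightarrow> w"
  shows "w \<in> sum_decomp Si (x, u)"
proof -
  have "(x, w $ i) \<in> gph (Si i)" for i
  proof (rule closed_sequentially)
    show "closed (gph (Si i))"
      using osc by (simp add: outer_semicontinuous_def)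
    show "(xs j, ws j $ i) \<in> gph (Si i)" for j
      using dec[of j] by (simp add: sum_decomp_def gph_def)
    show "(\<lambda>j. (xs j, ws j $ i)) \<longlonglongrightarrow> (x, w $ i)"
      by (intro tendsto_intros lim)
  qed
  moreover have "(\<Sum>i\<in>UNIV. w $ i) = u"
  proof (rule LIMSEQ_unique[OF _ lim(2)])
    have "(\<lambda>j. \<Sum>i\<in>UNIV. ws j $ i) \<longlonglongrightarrow> (\<Sum>i\<in>UNIV. w $ i)"
      by (intro tendsto_intros lim)
    then show "us \<longlonglongrightarrow> (\<Sum>i\<in>UNIV. w $ i)"
      using dec by (simp add: sum_decomp_def)
  qed
  ultimately show ?thesis
    by (simp add: sum_decomp_def gph_def)
qed

lemma dir_decomp_limit:
  fixes Si :: "'p::finite \<Rightarrow> ('a::euclidean_space, 'b::euclidean_space) multifun"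
  assumes w: "w \<in> sum_decomp Si (x, u)"
    and \<tau>: "\<And>j. \<tau> j > (0::real)" "\<tau> \<longlonglongrightarrow> 0" and hs: "hs \<longlonglongrightarrow> h" and ks: "ks \<longlonglongrightarrow> k"
    and dec: "\<And>j. w + \<tau> j *\<^sub>R ks j \<in> sum_decomp Si (x + \<tau> j *\<^sub>R hs j, us j)"
    and sums: "(\<lambda>j. \<Sum>i\<in>UNIV. ks j $ i) \<longlonglongrightarrow> l"
  shows "k \<in> dir_decomp Si x w h l"
proof -
  have "(h, k $ i) \<in> tangent_cone (gph (Si i)) (x, w $ i)" for i
  proof -
    have "(x, w $ i) \<in> gph (Si i)"
      using w by (auto simp: sum_decomp_def gph_def)
    moreover have "(\<lambda>j. (hs j, ks j $ i)) \<longlonglongrightarrow> (h, k $ i)"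
      by (intro tendsto_intros hs ks)
    moreover have "(x, w $ i) + \<tau> j *\<^sub>R (hs j, ks j $ i) \<in> gph (Si i)" for j
      using dec[of j] by (auto simp: sum_decomp_def gph_def)
    ultimately show ?thesis
      using \<tau> unfolding tangent_cone_def
      by (auto intro!: exI[of _ \<tau>] exI[of _ "\<lambda>j. (hs j, ks j $ i)"])
  qed
  moreover have "(\<Sum>i\<in>UNIV. k $ i) = l"
  proof (rule LIMSEQ_unique[OF _ sums])
    show "(\<lambda>j. \<Sum>i\<in>UNIV. ks j $ i) \<longlonglongrightarrow> (\<Sum>i\<in>UNIV. k $ i)"
      by (intro tendsto_intros ks)
  qed
  ultimately show ?thesis
    by (simp add: dir_decomp_def graph_deriv_def)
qed

text \<open>
  The approximate sum rule is applied at every point of a sequence approaching \<open>(x, w)\<close> in the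
  direction \<open>(h, k)\<close> with step \<open>\<tau>\<close>. The tolerance is taken as \<open>\<epsilon> j = \<tau> j / (j + 1)\<close>, of smaller
  order than the step, so that the perturbed points of the individual graphs still approach
  \<open>(x, w $ i)\<close> in the direction \<open>(h, k $ i)\<close>. Subregularity holds with one modulus along the
  whole tail of the sequence, hence the multipliers are bounded and a subsequence of them converges.
  The step \<open>\<tau>\<close> is arbitrary here: it need not be the one that comes with the normal to the sum.
\<close>

lemma dir_coderiv_sum_limit:
  fixes Si :: "'p::finite \<Rightarrow> ('a::euclidean_space, 'b::euclidean_space) multifun"
  assumes osc: "\<And>i. outer_semicontinuous (Si i)"
    and \<tau>: "\<And>j. \<tau> j > (0::real)" "\<tau> \<longlonglongrightarrow> 0" and hs: "hs \<longlonglongrightarrow> h" and ks: "ks \<longlonglongrightarrow> k"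
    and dec: "\<And>j. w + \<tau> j *\<^sub>R ks j \<in> sum_decomp Si (x + \<tau> j *\<^sub>R hs j, us j)"
    and nrm: "\<And>j. (x's j, - u's j) \<in> regular_normal_cone (gph (mf_sum Si)) (x + \<tau> j *\<^sub>R hs j, us j)"
    and x's: "x's \<longlonglongrightarrow> x'" and u's: "u's \<longlonglongrightarrow> u'"
    and subreg: "dir_metrically_subregular (sum_constraint Si)
      ((x, (\<chi> i. x), w), 0) (h, (\<chi> i. h), k)"
  shows "x' \<in> (\<Sum>i\<in>UNIV. dir_coderiv (Si i) (x, w $ i) (h, k $ i) u')"
proof -
  obtain \<kappa> U where \<kappa>: "\<kappa> > 0" and U: "dir_nbhd (h, (\<chi> i. h), k) U"
    and near: "\<And>z. z \<in> graph_prod Si \<Longrightarrow> z - (x, (\<chi> i. x), w) \<in> U \<Longrightarrow>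
      \<exists>z'\<in>graph_prod Si. consensus_gap z' = 0 \<and> norm (z' - z) \<le> \<kappa> * norm (consensus_gap z)"
    using sum_constraint_subregular_near[OF subreg] by blast
  define \<epsilon> where "\<epsilon> j = \<tau> j / real (Suc j)" for j
  have \<epsilon>: "\<epsilon> j > 0" for j
    using \<tau> by (simp add: \<epsilon>_def)
  define B where "B j = 2 * \<kappa> * (norm (x's j, 0::'a ^ 'p, (\<chi> i. - u's j) :: 'b ^ 'p) + \<epsilon> j) + \<epsilon> j" for j
  have inv0: "(\<lambda>j. 1 / real (Suc j)) \<longlonglongrightarrow> 0"
    using LIMSEQ_inverse_real_of_nat by (simp add: inverse_eq_divide)
  have \<epsilon>0: "\<epsilon> \<longlonglongrightarrow> 0"
    using tendsto_mult[OF \<tau>(2) inv0] by (simp add: \<epsilon>_def[abs_def])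
  have "(\<lambda>j. (hs j, (\<chi> i. hs j) :: 'a ^ 'p, ks j)) \<longlonglongrightarrow> (h, (\<chi> i. h), k)"
    by (intro tendsto_intros hs ks)
  from dir_nbhd_eventually_interior[OF U \<tau> this]
  have "\<forall>\<^sub>F j in sequentially. \<exists>v w' b c. norm (v - (\<chi> i. x + \<tau> j *\<^sub>R hs j)) \<le> \<epsilon> j \<and>
      norm (w' - (w + \<tau> j *\<^sub>R ks j)) \<le> \<epsilon> j \<and> norm b \<le> B j \<and>
      norm ((\<Sum>i\<in>UNIV. b $ i) - x's j) \<le> (1 + real CARD('p)) * \<epsilon> j \<and>
      norm (c - (\<chi> i. - u's j)) \<le> \<epsilon> j \<and>
      (\<forall>i. (b $ i, c $ i) \<in> regular_normal_cone (gph (Si i)) (v $ i, w' $ i))"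
  proof eventually_elim
    case (elim j)
    let ?z = "(x + \<tau> j *\<^sub>R hs j, (\<chi> i. x + \<tau> j *\<^sub>R hs j), w + \<tau> j *\<^sub>R ks j)"
    let ?d = "\<tau> j *\<^sub>R (hs j, (\<chi> i. hs j) :: 'a ^ 'p, ks j)"
    obtain r where r: "r > 0" "cball ?d r \<subseteq> U"
      using elim by (auto simp: mem_interior_cball)
    have "z - (x, (\<chi> i. x), w) \<in> U" if "norm (z - ?z) \<le> r" for z
    proof -
      have d: "?d = ?z - (x, (\<chi> i. x), w)"
        by (simp add: vec_eq_iff)
      have "dist (a - q) (z - q) = norm (z - a)" for a q
        by (simp add: dist_norm norm_minus_commute)
      then have "dist ?d (z - (x, (\<chi> i. x), w)) = norm (z - ?z)"
        by (simp only: d)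
      then show ?thesis using r(2) that by auto
    qed
    then have "\<exists>z'\<in>graph_prod Si. consensus_gap z' = 0 \<and> norm (z' - z) \<le> \<kappa> * norm (consensus_gap z)"
      if "z \<in> graph_prod Si" "norm (z - ?z) \<le> r" for z
      using near that by blast
    from fuzzy_sum_rule[where Si = Si, OF osc dec nrm r(1) \<kappa> this \<epsilon>[of j]]
    show ?case by (simp only: B_def)
  qed
  then obtain N where "\<forall>j. \<exists>v w' b c. norm (v - (\<chi> i. x + \<tau> (j + N) *\<^sub>R hs (j + N))) \<le> \<epsilon> (j + N) \<and>
      norm (w' - (w + \<tau> (j + N) *\<^sub>R ks (j + N))) \<le> \<epsilon> (j + N) \<and> norm b \<le> B (j + N) \<and>
      norm ((\<Sum>i\<in>UNIV. b $ i) - x's (j + N)) \<le> (1 + real CARD('p)) * \<epsilon> (j + N) \<and>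
      norm (c - (\<chi> i. - u's (j + N))) \<le> \<epsilon> (j + N) \<and>
      (\<forall>i. (b $ i, c $ i) \<in> regular_normal_cone (gph (Si i)) (v $ i, w' $ i))"
    unfolding eventually_sequentially by (meson le_add2)
  then obtain v w' b c where
    v: "\<And>j. norm (v j - (\<chi> i. x + \<tau> (j + N) *\<^sub>R hs (j + N))) \<le> \<epsilon> (j + N)" and
    w': "\<And>j. norm (w' j - (w + \<tau> (j + N) *\<^sub>R ks (j + N))) \<le> \<epsilon> (j + N)" and
    b: "\<And>j. norm (b j) \<le> B (j + N)" and
    b': "\<And>j. norm ((\<Sum>i\<in>UNIV. b j $ i) - x's (j + N)) \<le> (1 + real CARD('p)) * \<epsilon> (j + N)" and
    c: "\<And>j. norm (c j - (\<chi> i. - u's (j + N))) \<le> \<epsilon> (j + N)" and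
    bc: "\<And>j i. (b j $ i, c j $ i) \<in> regular_normal_cone (gph (Si i)) (v j $ i, w' j $ i)"
    by metis
  have "B \<longlonglongrightarrow> 2 * \<kappa> * (norm (x', 0::'a ^ 'p, (\<chi> i. - u') :: 'b ^ 'p) + 0) + 0"
    unfolding B_def[abs_def] by (intro tendsto_intros x's u's \<epsilon>0)
  then have "convergent B"
    by (rule convergentI)
  then have "Bseq B"
    by (rule convergent_imp_Bseq)
  then obtain M where M: "\<And>j. norm (B j) \<le> M"
    by (auto simp: Bseq_def)
  have "norm (b j) \<le> M" for j
    using b[of j] M[of "j + N"] by simp
  then have "bounded (range b)"
    by (auto simp: bounded_iff)
  then obtain \<beta> \<sigma> where \<sigma>: "strict_mono (\<sigma> :: nat \<Rightarrow> nat)" and \<beta>: "(b \<circ> \<sigma>) \<longlonglongrightarrow> \<beta>"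
    using bounded_imp_convergent_subsequence by blast
  define g where "g j = \<sigma> j + N" for j
  have g: "strict_mono g"
    using \<sigma> by (auto simp: g_def strict_mono_def)
  note sub = LIMSEQ_subseq_LIMSEQ[OF _ g, unfolded o_def]
  have \<epsilon>g: "(\<lambda>j. \<epsilon> (g j)) \<longlonglongrightarrow> 0"
    by (rule sub[OF \<epsilon>0])
  have \<beta>': "(\<lambda>j. b (\<sigma> j)) \<longlonglongrightarrow> \<beta>"
    using \<beta> by (simp add: o_def)
  have "(\<lambda>j. (\<Sum>i\<in>UNIV. b (\<sigma> j) $ i) - x's (g j)) \<longlonglongrightarrow> 0"
  proof (rule Lim_null_comparison)
    show "\<forall>\<^sub>F j in sequentially. norm ((\<Sum>i\<in>UNIV. b (\<sigma> j) $ i) - x's (g j)) \<le> (1 + real CARD('p)) * \<epsilon> (g j)"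
      using b' by (simp add: g_def)
    show "(\<lambda>j. (1 + real CARD('p)) * \<epsilon> (g j)) \<longlonglongrightarrow> 0"
      using tendsto_mult_left[OF \<epsilon>g] by simp
  qed
  moreover have "(\<lambda>j. (\<Sum>i\<in>UNIV. b (\<sigma> j) $ i) - x's (g j)) \<longlonglongrightarrow> (\<Sum>i\<in>UNIV. \<beta> $ i) - x'"
    by (intro tendsto_intros \<beta>' sub[OF x's])
  ultimately have sum: "(\<Sum>i\<in>UNIV. \<beta> $ i) = x'"
    using LIMSEQ_unique by fastforce
  have "\<beta> $ i \<in> dir_coderiv (Si i) (x, w $ i) (h, k $ i) u'" for i
  proof -
    (* Perturbing by o(\<tau>) does not change the limit of the difference quotients. *)
    have quot: "(\<lambda>j. (y j - a) /\<^sub>R \<tau> (g j)) \<longlonglongrightarrow> q"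
      if y: "\<And>j. norm (y j - (a + \<tau> (g j) *\<^sub>R qs (g j))) \<le> \<epsilon> (g j)" and qs: "qs \<longlonglongrightarrow> q"
      for y :: "nat \<Rightarrow> 'e::real_normed_vector" and a qs q
    proof -
      have "(\<lambda>j. (y j - a) /\<^sub>R \<tau> (g j) - qs (g j)) \<longlonglongrightarrow> 0"
      proof (rule Lim_null_comparison[OF _ sub[OF inv0]], intro always_eventually allI)
        fix j
        have "(y j - a) /\<^sub>R \<tau> (g j) - qs (g j) = (y j - (a + \<tau> (g j) *\<^sub>R qs (g j))) /\<^sub>R \<tau> (g j)"
          using \<tau>(1)[of "g j"] by (simp add: algebra_simps)
        then have "norm ((y j - a) /\<^sub>R \<tau> (g j) - qs (g j)) \<le> \<epsilon> (g j) / \<tau> (g j)"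
          using \<tau>(1)[of "g j"] y[of j] by (simp add: divide_inverse_commute)
        then show "norm ((y j - a) /\<^sub>R \<tau> (g j) - qs (g j)) \<le> 1 / real (Suc (g j))"
          using \<tau>(1)[of "g j"] by (simp add: \<epsilon>_def)
      qed
      from tendsto_add[OF this sub[OF qs]] show ?thesis by simp
    qed
    define p where "p j = ((v (\<sigma> j) $ i - x) /\<^sub>R \<tau> (g j), (w' (\<sigma> j) $ i - w $ i) /\<^sub>R \<tau> (g j))" for j
    have "(\<lambda>j. (v (\<sigma> j) $ i - x) /\<^sub>R \<tau> (g j)) \<longlonglongrightarrow> h"
    proof (rule quot[OF _ hs])
      show "norm (v (\<sigma> j) $ i - (x + \<tau> (g j) *\<^sub>R hs (g j))) \<le> \<epsilon> (g j)" for j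
        using order_trans[OF Finite_Cartesian_Product.norm_nth_le v[of "\<sigma> j"], of i] by (simp add: g_def)
    qed
    moreover have "(\<lambda>j. (w' (\<sigma> j) $ i - w $ i) /\<^sub>R \<tau> (g j)) \<longlonglongrightarrow> k $ i"
    proof (rule quot)
      show "norm (w' (\<sigma> j) $ i - (w $ i + \<tau> (g j) *\<^sub>R (ks (g j) $ i))) \<le> \<epsilon> (g j)" for j
        using order_trans[OF Finite_Cartesian_Product.norm_nth_le w'[of "\<sigma> j"], of i] by (simp add: g_def)
      show "(\<lambda>j. ks j $ i) \<longlonglongrightarrow> k $ i"
        by (intro tendsto_intros ks)
    qed
    ultimately have p: "p \<longlonglongrightarrow> (h, k $ i)"
      unfolding p_def[abs_def] by (rule tendsto_Pair)
    have "(\<lambda>j. c (\<sigma> j) - (\<chi> i. - u's (g j))) \<longlonglongrightarrow> 0"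
      by (rule Lim_null_comparison[OF _ \<epsilon>g]) (use c in \<open>simp add: g_def\<close>)
    moreover have "(\<lambda>j. (\<chi> i. - u's (g j)) :: 'b ^ 'p) \<longlonglongrightarrow> (\<chi> i. - u')"
      by (intro tendsto_intros sub[OF u's])
    ultimately have "(\<lambda>j. c (\<sigma> j)) \<longlonglongrightarrow> (\<chi> i. - u')"
      using tendsto_add by fastforce
    then have "(\<lambda>j. c (\<sigma> j) $ i) \<longlonglongrightarrow> (\<chi> i. - u') $ i"
      by (rule tendsto_vec_nth)
    then have "(\<lambda>j. (b (\<sigma> j) $ i, c (\<sigma> j) $ i)) \<longlonglongrightarrow> (\<beta> $ i, - u')"
      by (intro tendsto_intros \<beta>') simp
    moreover have "(b (\<sigma> j) $ i, c (\<sigma> j) $ i) \<in>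
        regular_normal_cone (gph (Si i)) ((x, w $ i) + \<tau> (g j) *\<^sub>R p j)" for j
      using bc[of "\<sigma> j" i] \<tau>(1)[of "g j"] by (simp add: p_def)
    ultimately show ?thesis
      unfolding dir_coderiv_def dir_normal_cone_def mem_Collect_eq using p \<tau>(1) sub[OF \<tau>(2)]
      by - (rule exI[of _ "\<lambda>j. \<tau> (g j)"], rule exI[of _ p],
          rule exI[of _ "\<lambda>j. (b (\<sigma> j) $ i, c (\<sigma> j) $ i)"], simp)
  qed
  then show ?thesis
    using sum by (auto simp: set_sum_alt intro!: exI[of _ "\<lambda>i. \<beta> $ i"])
qed

section \<open>The coderivative of a sum\<close>

theorem theorem5p2:
  fixes Si :: "'p::finite \<Rightarrow> (real ^ 'n, real ^ 'm) multifun"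
    and S :: "(real ^ 'n, real ^ 'm) multifun"
    and x0 h :: "real ^ 'n" and u0 l :: "real ^ 'm"
  assumes S_sum: "S = mf_sum Si"
    and osc: "\<And>i. outer_semicontinuous (Si i)"
    and x0: "x0 \<in> mf_dom S"
    and u0: "u0 \<in> S x0"
    and bdd: "\<exists>U. dir_nbhd (h, l) U \<and>
               bounded (\<Union>z \<in> (+) (x0, u0) ` U. sum_decomp Si z)"
    and subreg: "\<And>w k. w \<in> sum_decomp Si (x0, u0) \<Longrightarrow> k \<in> dir_decomp Si x0 w h l \<Longrightarrow>
               dir_metrically_subregular (sum_constraint Si)
                 ((x0, (\<chi> i. x0), w), 0) (h, (\<chi> i. h), k)"
    and subreg0: "\<And>w k. w \<in> sum_decomp Si (x0, u0) \<Longrightarrow>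
               k \<in> dir_decomp Si x0 w 0 0 \<inter> sphere 0 1 \<Longrightarrow>
               dir_metrically_subregular (sum_constraint Si)
                 ((x0, (\<chi> i. x0), w), 0) (0, (\<chi> i. 0), k)"
  shows "\<forall>u'. dir_coderiv S (x0, u0) (h, l) u' \<subseteq>
    (\<Union>w \<in> sum_decomp Si (x0, u0).
       (\<Union>k \<in> dir_decomp Si x0 w h l.
          \<Sum>i\<in>UNIV. dir_coderiv (Si i) (x0, w $ i) (h, k $ i) u')
     \<union> (\<Union>k \<in> dir_decomp Si x0 w 0 0 \<inter> sphere 0 1.
          \<Sum>i\<in>UNIV. dir_coderiv (Si i) (x0, w $ i) (0, k $ i) u'))"
proof (intro allI subsetI)
  fix u' x'
  assume "x' \<in> dir_coderiv S (x0, u0) (h, l) u'"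
  then obtain t d \<xi> where t: "\<And>j. t j > (0::real)" "t \<longlonglongrightarrow> 0"
    and d: "d \<longlonglongrightarrow> (h, l)" and \<xi>: "\<xi> \<longlonglongrightarrow> (x', - u')"
    and nrm: "\<And>j. \<xi> j \<in> regular_normal_cone (gph S) ((x0, u0) + t j *\<^sub>R d j)"
    unfolding dir_coderiv_def dir_normal_cone_def by blast
  have "sum_decomp Si ((x0, u0) + t j *\<^sub>R d j) \<noteq> {}" for j
    using nrm[of j] by (simp add: regular_normal_cone_iff gph_mf_sum S_sum)
  then have "\<forall>j. \<exists>w. w \<in> sum_decomp Si ((x0, u0) + t j *\<^sub>R d j)"
    by blast
  from choice[OF this] obtain ws
    where ws: "\<And>j. ws j \<in> sum_decomp Si ((x0, u0) + t j *\<^sub>R d j)"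
    by blast
  obtain U where U: "dir_nbhd (h, l) U"
    and bU: "bounded (\<Union>z \<in> (+) (x0, u0) ` U. sum_decomp Si z)"
    using bdd by blast
  have "\<forall>\<^sub>F j in sequentially. t j *\<^sub>R d j \<in> U"
    using dir_nbhd_eventually_interior[OF U t d] by (rule eventually_mono) (use interior_subset in blast)
  then obtain N where N: "\<And>j. j \<ge> N \<Longrightarrow> t j *\<^sub>R d j \<in> U"
    unfolding eventually_sequentially by blast
  have "range (\<lambda>j. ws (j + N)) \<subseteq> (\<Union>z \<in> (+) (x0, u0) ` U. sum_decomp Si z)"
    using ws N by fastforce
  then have "bounded (range (\<lambda>j. ws (j + N)))"
    using bU bounded_subset by blast
  then obtain w \<sigma> where \<sigma>: "strict_mono (\<sigma> :: nat \<Rightarrow> nat)" and w: "((\<lambda>j. ws (j + N)) \<circ> \<sigma>) \<longlonglongrightarrow> w"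
    using bounded_imp_convergent_subsequence by blast
  define g where "g j = \<sigma> j + N" for j
  have g: "strict_mono g"
    using \<sigma> by (auto simp: g_def strict_mono_def)
  define T where "T j = t (g j)" for j
  define W where "W j = ws (g j)" for j
  define H where "H j = fst (d (g j))" for j
  define L where "L j = snd (d (g j))" for j
  define X where "X j = fst (\<xi> (g j))" for j
  define Y where "Y j = - snd (\<xi> (g j))" for j
  note sub = LIMSEQ_subseq_LIMSEQ[OF _ g, unfolded o_def]
  have T: "T j > 0" for j
    using t by (simp add: T_def)
  have T0: "T \<longlonglongrightarrow> 0"
    unfolding T_def[abs_def] by (rule sub[OF t(2)])
  have W0: "W \<longlonglongrightarrow> w"
    using w by (simp add: W_def[abs_def] g_def o_def)
  have HL: "H \<longlonglongrightarrow> h" "L \<longlonglongrightarrow> l"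
    using tendsto_fst[OF sub[OF d]] tendsto_snd[OF sub[OF d]]
    by (simp_all add: H_def[abs_def] L_def[abs_def])
  have XY: "X \<longlonglongrightarrow> x'" "Y \<longlonglongrightarrow> u'"
    using tendsto_fst[OF sub[OF \<xi>]] tendsto_minus[OF tendsto_snd[OF sub[OF \<xi>]]]
    by (simp_all add: X_def[abs_def] Y_def[abs_def])
  have dec: "W j \<in> sum_decomp Si (x0 + T j *\<^sub>R H j, u0 + T j *\<^sub>R L j)" for j
    using ws[of "g j"] by (cases "d (g j)") (simp add: W_def T_def H_def L_def)
  have nrm': "(X j, - Y j) \<in> regular_normal_cone (gph (mf_sum Si)) (x0 + T j *\<^sub>R H j, u0 + T j *\<^sub>R L j)" for j
    using nrm[of "g j"] by (cases "d (g j)") (simp add: X_def Y_def T_def H_def L_def S_sum)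
  have w_dec: "w \<in> sum_decomp Si (x0, u0)"
  proof (rule sum_decomp_limit[where Si = Si, OF osc dec _ _ W0])
    show "(\<lambda>j. x0 + T j *\<^sub>R H j) \<longlonglongrightarrow> x0"
      using tendsto_add[OF tendsto_const tendsto_scaleR[OF T0 HL(1)]] by simp
    show "(\<lambda>j. u0 + T j *\<^sub>R L j) \<longlonglongrightarrow> u0"
      using tendsto_add[OF tendsto_const tendsto_scaleR[OF T0 HL(2)]] by simp
  qed
  have sumW: "(\<Sum>i\<in>UNIV. (W j - w) $ i) = T j *\<^sub>R L j" for j
    using dec[of j] w_dec by (simp add: sum_decomp_def sum_subtractf)
  (* Whether these quotients stay bounded decides which part of the union contains x'. *)
  define Q where "Q j = (W j - w) /\<^sub>R T j" for j
  have WQ: "w + T j *\<^sub>R Q j = W j" for j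
    using T[of j] by (simp add: Q_def)
  have sumQ: "(\<Sum>i\<in>UNIV. Q j $ i) = L j" for j
    using sumW[of j] T[of j] by (simp add: Q_def scaleR_sum_right[symmetric])
  have "(\<exists>k \<in> dir_decomp Si x0 w h l. x' \<in> (\<Sum>i\<in>UNIV. dir_coderiv (Si i) (x0, w $ i) (h, k $ i) u')) \<or>
    (\<exists>k \<in> dir_decomp Si x0 w 0 0 \<inter> sphere 0 1.
      x' \<in> (\<Sum>i\<in>UNIV. dir_coderiv (Si i) (x0, w $ i) (0, k $ i) u'))"
  proof (cases "bounded (range Q)")
    case True
    then obtain k \<rho> where \<rho>: "strict_mono (\<rho> :: nat \<Rightarrow> nat)" and k: "(Q \<circ> \<rho>) \<longlonglongrightarrow> k"
      using bounded_imp_convergent_subsequence by blast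
    note sub' = LIMSEQ_subseq_LIMSEQ[OF _ \<rho>, unfolded o_def]
    have k': "(\<lambda>j. Q (\<rho> j)) \<longlonglongrightarrow> k"
      using k by (simp add: o_def)
    have dec': "w + T (\<rho> j) *\<^sub>R Q (\<rho> j) \<in>
        sum_decomp Si (x0 + T (\<rho> j) *\<^sub>R H (\<rho> j), u0 + T (\<rho> j) *\<^sub>R L (\<rho> j))" for j
      using dec by (simp add: WQ)
    have "(\<lambda>j. \<Sum>i\<in>UNIV. Q (\<rho> j) $ i) \<longlonglongrightarrow> l"
      using sub'[OF HL(2)] by (simp add: sumQ)
    then have kd: "k \<in> dir_decomp Si x0 w h l"
      by (rule dir_decomp_limit[OF w_dec T sub'[OF T0] sub'[OF HL(1)] k' dec'])
    have "x' \<in> (\<Sum>i\<in>UNIV. dir_coderiv (Si i) (x0, w $ i) (h, k $ i) u')"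
      by (rule dir_coderiv_sum_limit[where Si = Si, OF osc T sub'[OF T0] sub'[OF HL(1)] k' dec' nrm'
            sub'[OF XY(1)] sub'[OF XY(2)] subreg[OF w_dec kd]])
    with kd show ?thesis by blast
  next
    case False
    (* Along a subsequence with unbounded quotients the step norm (W - w) replaces T. *)
    have "\<exists>m\<ge>n. norm (Q m) > real n" for n
    proof (rule ccontr)
      assume "\<not> ?thesis"
      then have "\<And>m. norm (Q (m + n)) \<le> real n"
        by (auto simp: not_less)
      then have "Bseq (\<lambda>m. Q (m + n))"
        by (rule BseqI')
      then have "Bseq Q"
        by (rule Bseq_offset)
      with False show False
        by (simp add: Bseq_eq_bounded)
    qed
    then obtain m where m: "\<And>n. m n \<ge> n" "\<And>n. norm (Q (m n)) > real n"
      by metis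
    have Qpos: "norm (Q (m n)) > 0" for n
      using m(2)[of n] by (meson le_less_trans of_nat_0_le_iff)
    define k0 where "k0 n = Q (m n) /\<^sub>R norm (Q (m n))" for n
    have "norm (k0 n) = 1" for n
      using Qpos[of n] by (simp add: k0_def)
    then have k0: "range k0 \<subseteq> sphere 0 1"
      by auto
    then have "bounded (range k0)"
      using bounded_sphere bounded_subset by blast
    then obtain k \<rho> where \<rho>: "strict_mono (\<rho> :: nat \<Rightarrow> nat)" and k: "(k0 \<circ> \<rho>) \<longlonglongrightarrow> k"
      using bounded_imp_convergent_subsequence by blast
    define f where "f n = m (\<rho> n)" for n
    have f: "filterlim f sequentially sequentially"
    proof (rule filterlim_at_top_mono[OF filterlim_ident])
      show "\<forall>\<^sub>F n in sequentially. n \<le> f n"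
        using m(1) seq_suble[OF \<rho>] order_trans unfolding f_def by (intro always_eventually) blast
    qed
    note sub' = filterlim_compose[OF _ f]
    have k': "(\<lambda>n. k0 (\<rho> n)) \<longlonglongrightarrow> k"
      using k by (simp add: o_def)
    have k_sphere: "k \<in> sphere 0 1"
      by (rule closed_sequentially[OF closed_sphere _ k']) (use k0 in blast)
    define q where "q n = norm (Q (f n))" for n
    define \<tau> where "\<tau> n = T (f n) * q n" for n
    have q: "inverse (q n) \<le> inverse (real (\<rho> n))" if "\<rho> n > 0" for n
      using Qpos[of "\<rho> n"] m(2)[of "\<rho> n"] that by (auto simp: q_def f_def intro!: le_imp_inverse_le)
    have q_pos: "q n > 0" for n
      using Qpos by (simp add: q_def f_def)
    have \<tau>: "\<tau> n > 0" for n
      using q_pos T by (simp add: \<tau>_def)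
    have q_inv: "(\<lambda>n. inverse (q n)) \<longlonglongrightarrow> 0"
    proof (rule tendsto_sandwich[OF _ _ tendsto_const])
      show "(\<lambda>n. inverse (real (\<rho> n))) \<longlonglongrightarrow> 0"
        using LIMSEQ_subseq_LIMSEQ[OF lim_inverse_n \<rho>] by (simp add: o_def)
      show "\<forall>\<^sub>F n in sequentially. inverse (q n) \<le> inverse (real (\<rho> n))"
        using q seq_suble[OF \<rho>] by (intro eventually_sequentiallyI[of 1]) (meson le_trans less_le_trans zero_less_one)
      show "\<forall>\<^sub>F n in sequentially. 0 \<le> inverse (q n)"
        using q_pos by (intro always_eventually) (simp add: less_imp_le)
    qed
    have \<tau>_norm: "\<tau> n = norm (W (f n) - w)" for n
      using T[of "f n"] by (simp add: \<tau>_def q_def Q_def)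
    have \<tau>0: "\<tau> \<longlonglongrightarrow> 0"
    proof -
      have "(\<lambda>n. norm (W (f n) - w)) \<longlonglongrightarrow> norm (w - w)"
        by (intro tendsto_intros sub'[OF W0])
      then show ?thesis by (simp add: \<tau>_norm[abs_def])
    qed
    have hs: "(\<lambda>n. inverse (q n) *\<^sub>R H (f n)) \<longlonglongrightarrow> 0"
      using tendsto_scaleR[OF q_inv sub'[OF HL(1)]] by simp
    have scale: "\<tau> n *\<^sub>R inverse (q n) *\<^sub>R y = T (f n) *\<^sub>R y" for n and y :: "real ^ 'n"
      using q_pos[of n] by (simp add: \<tau>_def)
    have k0W: "w + \<tau> n *\<^sub>R k0 (\<rho> n) = W (f n)" for n
      using Qpos[of "\<rho> n"] WQ[of "f n"] by (simp add: \<tau>_def k0_def q_def f_def mult.assoc)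
    have dec': "w + \<tau> n *\<^sub>R k0 (\<rho> n) \<in>
        sum_decomp Si (x0 + \<tau> n *\<^sub>R inverse (q n) *\<^sub>R H (f n), u0 + T (f n) *\<^sub>R L (f n))" for n
      using dec unfolding k0W scale .
    have nrm'': "(X (f n), - Y (f n)) \<in> regular_normal_cone (gph (mf_sum Si))
        (x0 + \<tau> n *\<^sub>R inverse (q n) *\<^sub>R H (f n), u0 + T (f n) *\<^sub>R L (f n))" for n
      using nrm' unfolding scale .
    have "(\<Sum>i\<in>UNIV. k0 (\<rho> n) $ i) = inverse (q n) *\<^sub>R L (f n)" for n
      using sumQ[of "f n"] by (simp add: k0_def q_def f_def scaleR_sum_right[symmetric])
    then have "(\<lambda>n. \<Sum>i\<in>UNIV. k0 (\<rho> n) $ i) \<longlonglongrightarrow> 0"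
      using tendsto_scaleR[OF q_inv sub'[OF HL(2)]] by simp
    then have "k \<in> dir_decomp Si x0 w 0 0"
      by (rule dir_decomp_limit[OF w_dec \<tau> \<tau>0 hs k' dec'])
    with k_sphere have kd: "k \<in> dir_decomp Si x0 w 0 0 \<inter> sphere 0 1"
      by blast
    have "x' \<in> (\<Sum>i\<in>UNIV. dir_coderiv (Si i) (x0, w $ i) (0, k $ i) u')"
      by (rule dir_coderiv_sum_limit[where Si = Si, OF osc \<tau> \<tau>0 hs k' dec' nrm''
            sub'[OF XY(1)] sub'[OF XY(2)] subreg0[OF w_dec kd]])
    with kd show ?thesis by blast
  qed
  then show "x' \<in> (\<Union>w \<in> sum_decomp Si (x0, u0).
       (\<Union>k \<in> dir_decomp Si x0 w h l.
          \<Sum>i\<in>UNIV. dir_coderiv (Si i) (x0, w $ i) (h, k $ i) u')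
     \<union> (\<Union>k \<in> dir_decomp Si x0 w 0 0 \<inter> sphere 0 1.
          \<Sum>i\<in>UNIV. dir_coderiv (Si i) (x0, w $ i) (0, k $ i) u'))"
    using w_dec by blast
qed

end
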